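(* Suppose $h_0>h_0^\star$, let $\xi$ be the only positive solution of $F(x)=\frac{l\sqrt\pi}{D_\infty c_1}G(x)$, and let $(\theta_1,\theta_2,s,r)$ be the similarity solution (S) of the convective problem (P). Set $$D_0=\frac{D_\infty\operatorname{erf}(\xi)}{\operatorname{erf}(\xi)+\frac{k_1}{h_0\sqrt{\pi\alpha_1}}}>0,$$ and let $(\theta_1^\star,\theta_2^\star,s^\star,r^\star)$ be the similarity solution (S$^\star$) of the temperature problem (P$^\star$) with this value of $D_0$. Then the two solutions coincide: $\theta_1=\theta_1^\star$, $\theta_2=\theta_2^\star$, $s=s^\star$ and $r=r^\star$.
   Context: Parameters: $\rho,k_1,k_2,c_1,c_2,l,\gamma,\theta_0,D_\infty,h_0>0$ and $0<\epsilon<1$ are real constants; $\alpha_i=\frac{k_i}{\rho c_i}$ for $i=1,2$, and $\alpha_{12}=\frac{\alpha_1}{\alpha_2}$. As usual $\operatorname{erf}(x)=\frac{2}{\sqrt\pi}\int_0^x e^{-y^2}\,dy$ and $\operatorname{erfc}=1-\operatorname{erf}$. Common equations (C): $\alpha_1\theta_{1,xx}=\theta_{1,t}$ for $0<x<s(t)$, $t>0$; $\alpha_2\theta_{2,xx}=\theta_{2,t}$ for $x>r(t)$, $t>0$; $s(0)=r(0)=0$; $\theta_1(s(t),t)=\theta_2(r(t),t)=0$ for $t>0$; $\theta_2(x,0)=\theta_2(+\infty,t)=\theta_0$ for $x>0,t>0$; $k_1\theta_{1,x}(s(t),t)-k_2\theta_{2,x}(r(t),t)=\rho l[\epsilon\dot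 s(t)+(1-\epsilon)\dot r(t)]$ for $t>0$; $\theta_{1,x}(s(t),t)(r(t)-s(t))=\gamma$ for $t>0$. Problem (P): (C) together with $k_1\theta_{1,x}(0,t)=\frac{h_0}{\sqrt t}(\theta_1(0,t)+D_\infty)$ for $t>0$. Problem (P$^\star$), for a constant $D_0>0$: (C) together with $\theta_1(0,t)=-D_0$ for $t>0$. Functions for (P), $x>0$: $$W(x)=x+\frac{\gamma\sqrt\pi}{2D_\infty}e^{x^2}\left(\operatorname{erf}(x)+\frac{k_1}{h_0\sqrt{\alpha_1\pi}}\right),$$ $$F(x)=\frac{e^{-x^2}}{\operatorname{erf}(x)+\frac{k_1}{h_0\sqrt{\alpha_1\pi}}}-\frac{\theta_0\sqrt{k_2c_2}}{D_\infty\sqrt{k_1c_1}}\frac{\exp(-\alpha_{12}W^2(x))}{\operatorname{erfc}(\sqrt{\alpha_{12}}W(x))},$$ $$G(x)=x+\frac{(1-\epsilon)\gamma\sqrt\pi}{2D_\infty}e^{x^2}\left(\operatorname{erf}(x)+\frac{k_1}{h_0\sqrt{\alpha_1\pi}}\right).$$ Threshold: $h_0^\star=\frac{\gamma k_1}{2D_\infty\eta\sqrt{\alpha_2}}$, where $\eta$ is the only positive zero of $F_3(x)=\frac{e^{-x^2}}{\operatorname{erfc}(x)}-\frac{\gamma k_1\sqrt\pi}{2\theta_0k_2}\frac1x+\frac{(1-\epsilon)l\sqrt\pi}{\theta_0c_2}x$, $x>0$. For $h_0>h_0^\star$ the equation $F(x)=\frac{l\sqrt\pi}{D_\infty c_1}G(x)$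 has exactly one positive solution $\xi$. Solution (S) of (P), with this $\xi$ and $\mu=\sqrt{\alpha_{12}}W(\xi)$: $\theta_1(x,t)=-\frac{D_\infty\operatorname{erf}(\xi)}{\operatorname{erf}(\xi)+\frac{k_1}{h_0\sqrt{\pi\alpha_1}}}\left(1-\frac{\operatorname{erf}(x/(2\sqrt{\alpha_1t}))}{\operatorname{erf}(\xi)}\right)$ for $0<x<s(t)$; $\theta_2(x,t)=\frac{\theta_0\operatorname{erf}(\mu)}{\operatorname{erfc}(\mu)}\left(\frac{\operatorname{erf}(x/(2\sqrt{\alpha_2t}))}{\operatorname{erf}(\mu)}-1\right)$ for $x>r(t)$; $s(t)=2\xi\sqrt{\alpha_1t}$, $r(t)=2\mu\sqrt{\alpha_2t}$, $t>0$. Functions for (P$^\star$), $x>0$: $$W_0(x)=x+\frac{\gamma\sqrt\pi}{2D_0}e^{x^2}\operatorname{erf}(x),\qquad G_0(x)=x+\frac{(1-\epsilon)\gamma\sqrt\pi}{2D_0}e^{x^2}\operatorname{erf}(x),$$ $$F_0(x)=\frac{e^{-x^2}}{\operatorname{erf}(x)}-\frac{\theta_0\sqrt{k_2c_2}}{D_0\sqrt{k_1c_1}}\frac{\exp(-\alpha_{12}W_0^2(x))}{\operatorname{erfc}(\sqrt{\alpha_{12}}W_0(x))}.$$ Solution (S$^\star$) of (P$^\star$): with $\xi^\star$ the only positive solution of $F_0(x)=\frac{l\sqrt\pi}{D_0c_1}G_0(x)$ (known to exist and be unique) and $\mu^\star=\sqrt{\alpha_{12}}W_0(\xi^\star)$: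 $\theta_1^\star(x,t)=-D_0\left(1-\frac{\operatorname{erf}(x/(2\sqrt{\alpha_1t}))}{\operatorname{erf}(\xi^\star)}\right)$ for $0<x<s^\star(t)$; $\theta_2^\star(x,t)=\frac{\theta_0\operatorname{erf}(\mu^\star)}{\operatorname{erfc}(\mu^\star)}\left(\frac{\operatorname{erf}(x/(2\sqrt{\alpha_2t}))}{\operatorname{erf}(\mu^\star)}-1\right)$ for $x>r^\star(t)$; $s^\star(t)=2\xi^\star\sqrt{\alpha_1t}$, $r^\star(t)=2\mu^\star\sqrt{\alpha_2t}$, $t>0$. *)

theory Defs
  imports "HOL-Analysis.Analysis"
begin

text \<open>The integral is oriented, so that \<open>erf\<close> is odd.\<close>

definition erf :: "real \<Rightarrow> real" where
  "erf x = 2 / sqrt pi * (LBINT y=ereal 0..ereal x. exp (- (y\<^sup>2)))"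

definition erfc :: "real \<Rightarrow> real" where
  "erfc x = 1 - erf x"

text \<open>The constants shared by the convective and the temperature problem;
  \<open>\<l>\<close> is the latent heat.\<close>

record stefan_data =
  \<rho> :: real
  k\<^sub>1 :: real
  k\<^sub>2 :: real
  c\<^sub>1 :: real
  c\<^sub>2 :: real
  \<l> :: real
  \<gamma> :: real
  \<theta>\<^sub>0 :: real
  \<epsilon> :: real

definition admissible :: "stefan_data \<Rightarrow> bool" where
  "admissible M \<longleftrightarrow>
     0 < \<rho> M \<and> 0 < k\<^sub>1 M \<and> 0 < k\<^sub>2 M \<and> 0 < c\<^sub>1 M \<and> 0 < c\<^sub>2 M \<and>
     0 < \<l> M \<and> 0 < \<gamma> M \<and> 0 < \<theta>\<^sub>0 M \<and> 0 < \<epsilon> M \<and> \<epsilon> M < 1"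

definition \<alpha>\<^sub>1 :: "stefan_data \<Rightarrow> real" where
  "\<alpha>\<^sub>1 M = k\<^sub>1 M / (\<rho> M * c\<^sub>1 M)"

definition \<alpha>\<^sub>2 :: "stefan_data \<Rightarrow> real" where
  "\<alpha>\<^sub>2 M = k\<^sub>2 M / (\<rho> M * c\<^sub>2 M)"

definition \<alpha>\<^sub>1\<^sub>2 :: "stefan_data \<Rightarrow> real" where
  "\<alpha>\<^sub>1\<^sub>2 M = \<alpha>\<^sub>1 M / \<alpha>\<^sub>2 M"


section \<open>The free boundary problems\<close>

text \<open>\<open>heat_eq_at a u x t\<close>: the function \<open>u\<close> (space variable first) satisfies
  \<open>a * u_xx = u_t\<close> at \<open>(x, t)\<close>, with all derivatives existing there.\<close>

definition heat_eq_at :: "real \<Rightarrow> (real \<Rightarrow> real \<Rightarrow> real) \<Rightarrow> real \<Rightarrow> real \<Rightarrow> bool" where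
  "heat_eq_at a u x t \<longleftrightarrow>
     (\<exists>ux uxx ut.
        (\<forall>\<^sub>F y in nhds x. ((\<lambda>z. u z t) has_real_derivative ux y) (at y)) \<and>
        (ux has_real_derivative uxx) (at x) \<and>
        ((\<lambda>\<tau>. u x \<tau>) has_real_derivative ut) (at t) \<and>
        a * uxx = ut)"

text \<open>The conditions common to both problems.  Space derivatives at the fixed face and at the
  free boundaries are one-sided, taken from inside the respective phase.  The initial condition
  and the condition at infinity on \<open>\<theta>2\<close> are limits.\<close>

definition common_equations ::
  "stefan_data \<Rightarrow> (real \<Rightarrow> real \<Rightarrow> real) \<Rightarrow> (real \<Rightarrow> real \<Rightarrow> real) \<Rightarrow>
   (real \<Rightarrow> real) \<Rightarrow> (real \<Rightarrow> real) \<Rightarrow> bool" where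
  "common_equations M \<theta>1 \<theta>2 s r \<longleftrightarrow>
     (\<forall>t>0. \<forall>x. 0 < x \<and> x < s t \<longrightarrow> heat_eq_at (\<alpha>\<^sub>1 M) \<theta>1 x t) \<and>
     (\<forall>t>0. \<forall>x>r t. heat_eq_at (\<alpha>\<^sub>2 M) \<theta>2 x t) \<and>
     s 0 = 0 \<and> r 0 = 0 \<and>
     (\<forall>t>0. \<theta>1 (s t) t = 0 \<and> \<theta>2 (r t) t = 0) \<and>
     (\<forall>x>0. ((\<lambda>t. \<theta>2 x t) \<longlongrightarrow> \<theta>\<^sub>0 M) (at_right 0)) \<and>
     (\<forall>t>0. ((\<lambda>x. \<theta>2 x t) \<longlongrightarrow> \<theta>\<^sub>0 M) at_top) \<and>
     (\<forall>t>0. \<exists>\<theta>1x \<theta>2x s' r'.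
        ((\<lambda>x. \<theta>1 x t) has_real_derivative \<theta>1x) (at (s t) within {0..s t}) \<and>
        ((\<lambda>x. \<theta>2 x t) has_real_derivative \<theta>2x) (at (r t) within {r t..}) \<and>
        (s has_real_derivative s') (at t) \<and>
        (r has_real_derivative r') (at t) \<and>
        k\<^sub>1 M * \<theta>1x - k\<^sub>2 M * \<theta>2x = \<rho> M * \<l> M * (\<epsilon> M * s' + (1 - \<epsilon> M) * r') \<and>
        \<theta>1x * (r t - s t) = \<gamma> M)"

definition solves_convective_problem ::
  "stefan_data \<Rightarrow> real \<Rightarrow> real \<Rightarrow> (real \<Rightarrow> real \<Rightarrow> real) \<Rightarrow> (real \<Rightarrow> real \<Rightarrow> real) \<Rightarrow>
   (real \<Rightarrow> real) \<Rightarrow> (real \<Rightarrow> real) \<Rightarrow> bool" where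
  "solves_convective_problem M Dinf h\<^sub>0 \<theta>1 \<theta>2 s r \<longleftrightarrow>
     common_equations M \<theta>1 \<theta>2 s r \<and>
     (\<forall>t>0. \<exists>\<theta>1x.
        ((\<lambda>x. \<theta>1 x t) has_real_derivative \<theta>1x) (at 0 within {0..s t}) \<and>
        k\<^sub>1 M * \<theta>1x = h\<^sub>0 / sqrt t * (\<theta>1 0 t + Dinf))"

definition solves_temperature_problem ::
  "stefan_data \<Rightarrow> real \<Rightarrow> (real \<Rightarrow> real \<Rightarrow> real) \<Rightarrow> (real \<Rightarrow> real \<Rightarrow> real) \<Rightarrow>
   (real \<Rightarrow> real) \<Rightarrow> (real \<Rightarrow> real) \<Rightarrow> bool" where
  "solves_temperature_problem M D\<^sub>0 \<theta>1 \<theta>2 s r \<longleftrightarrow>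
     common_equations M \<theta>1 \<theta>2 s r \<and> (\<forall>t>0. \<theta>1 0 t = - D\<^sub>0)"


section \<open>Similarity solution of the convective problem\<close>

definition W_conv :: "stefan_data \<Rightarrow> real \<Rightarrow> real \<Rightarrow> real \<Rightarrow> real" where
  "W_conv M Dinf h\<^sub>0 x =
     x + \<gamma> M * sqrt pi / (2 * Dinf) * exp (x\<^sup>2) * (erf x + k\<^sub>1 M / (h\<^sub>0 * sqrt (\<alpha>\<^sub>1 M * pi)))"

definition F_conv :: "stefan_data \<Rightarrow> real \<Rightarrow> real \<Rightarrow> real \<Rightarrow> real" where
  "F_conv M Dinf h\<^sub>0 x =
     exp (- (x\<^sup>2)) / (erf x + k\<^sub>1 M / (h\<^sub>0 * sqrt (\<alpha>\<^sub>1 M * pi))) -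
     \<theta>\<^sub>0 M * sqrt (k\<^sub>2 M * c\<^sub>2 M) / (Dinf * sqrt (k\<^sub>1 M * c\<^sub>1 M)) *
       (exp (- (\<alpha>\<^sub>1\<^sub>2 M * (W_conv M Dinf h\<^sub>0 x)\<^sup>2)) / erfc (sqrt (\<alpha>\<^sub>1\<^sub>2 M) * W_conv M Dinf h\<^sub>0 x))"

definition G_conv :: "stefan_data \<Rightarrow> real \<Rightarrow> real \<Rightarrow> real \<Rightarrow> real" where
  "G_conv M Dinf h\<^sub>0 x =
     x + (1 - \<epsilon> M) * \<gamma> M * sqrt pi / (2 * Dinf) * exp (x\<^sup>2) *
       (erf x + k\<^sub>1 M / (h\<^sub>0 * sqrt (\<alpha>\<^sub>1 M * pi)))"

definition F\<^sub>3 :: "stefan_data \<Rightarrow> real \<Rightarrow> real" where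
  "F\<^sub>3 M x =
     exp (- (x\<^sup>2)) / erfc x - \<gamma> M * k\<^sub>1 M * sqrt pi / (2 * \<theta>\<^sub>0 M * k\<^sub>2 M) * (1 / x) +
     (1 - \<epsilon> M) * \<l> M * sqrt pi / (\<theta>\<^sub>0 M * c\<^sub>2 M) * x"

definition \<eta> :: "stefan_data \<Rightarrow> real" where
  "\<eta> M = (THE x. 0 < x \<and> F\<^sub>3 M x = 0)"

definition h_threshold :: "stefan_data \<Rightarrow> real \<Rightarrow> real" where
  "h_threshold M Dinf = \<gamma> M * k\<^sub>1 M / (2 * Dinf * \<eta> M * sqrt (\<alpha>\<^sub>2 M))"

definition \<xi>_conv :: "stefan_data \<Rightarrow> real \<Rightarrow> real \<Rightarrow> real" where
  "\<xi>_conv M Dinf h\<^sub>0 =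
     (THE x. 0 < x \<and> F_conv M Dinf h\<^sub>0 x = \<l> M * sqrt pi / (Dinf * c\<^sub>1 M) * G_conv M Dinf h\<^sub>0 x)"

definition \<mu>_conv :: "stefan_data \<Rightarrow> real \<Rightarrow> real \<Rightarrow> real" where
  "\<mu>_conv M Dinf h\<^sub>0 = sqrt (\<alpha>\<^sub>1\<^sub>2 M) * W_conv M Dinf h\<^sub>0 (\<xi>_conv M Dinf h\<^sub>0)"

text \<open>The formulas for the temperatures define total functions; they carry their meaning on
  \<open>0 \<le> x \<le> s t\<close> and \<open>x \<ge> r t\<close>, \<open>t > 0\<close>, respectively.\<close>

definition \<theta>1_conv :: "stefan_data \<Rightarrow> real \<Rightarrow> real \<Rightarrow> real \<Rightarrow> real \<Rightarrow> real" where
  "\<theta>1_conv M Dinf h\<^sub>0 x t =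
     (let \<xi> = \<xi>_conv M Dinf h\<^sub>0 in
       - (Dinf * erf \<xi> / (erf \<xi> + k\<^sub>1 M / (h\<^sub>0 * sqrt (pi * \<alpha>\<^sub>1 M)))) *
         (1 - erf (x / (2 * sqrt (\<alpha>\<^sub>1 M * t))) / erf \<xi>))"

definition \<theta>2_conv :: "stefan_data \<Rightarrow> real \<Rightarrow> real \<Rightarrow> real \<Rightarrow> real \<Rightarrow> real" where
  "\<theta>2_conv M Dinf h\<^sub>0 x t =
     (let \<mu> = \<mu>_conv M Dinf h\<^sub>0 in
       \<theta>\<^sub>0 M * erf \<mu> / erfc \<mu> * (erf (x / (2 * sqrt (\<alpha>\<^sub>2 M * t))) / erf \<mu> - 1))"

definition s_conv :: "stefan_data \<Rightarrow> real \<Rightarrow> real \<Rightarrow> real \<Rightarrow> real" where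
  "s_conv M Dinf h\<^sub>0 t = 2 * \<xi>_conv M Dinf h\<^sub>0 * sqrt (\<alpha>\<^sub>1 M * t)"

definition r_conv :: "stefan_data \<Rightarrow> real \<Rightarrow> real \<Rightarrow> real \<Rightarrow> real" where
  "r_conv M Dinf h\<^sub>0 t = 2 * \<mu>_conv M Dinf h\<^sub>0 * sqrt (\<alpha>\<^sub>2 M * t)"


section \<open>Similarity solution of the temperature problem\<close>

definition W_temp :: "stefan_data \<Rightarrow> real \<Rightarrow> real \<Rightarrow> real" where
  "W_temp M D\<^sub>0 x = x + \<gamma> M * sqrt pi / (2 * D\<^sub>0) * exp (x\<^sup>2) * erf x"

definition G_temp :: "stefan_data \<Rightarrow> real \<Rightarrow> real \<Rightarrow> real" where
  "G_temp M D\<^sub>0 x = x + (1 - \<epsilon> M) * \<gamma> M * sqrt pi / (2 * D\<^sub>0) * exp (x\<^sup>2) * erf x"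

definition F_temp :: "stefan_data \<Rightarrow> real \<Rightarrow> real \<Rightarrow> real" where
  "F_temp M D\<^sub>0 x =
     exp (- (x\<^sup>2)) / erf x -
     \<theta>\<^sub>0 M * sqrt (k\<^sub>2 M * c\<^sub>2 M) / (D\<^sub>0 * sqrt (k\<^sub>1 M * c\<^sub>1 M)) *
       (exp (- (\<alpha>\<^sub>1\<^sub>2 M * (W_temp M D\<^sub>0 x)\<^sup>2)) / erfc (sqrt (\<alpha>\<^sub>1\<^sub>2 M) * W_temp M D\<^sub>0 x))"

definition \<xi>_temp :: "stefan_data \<Rightarrow> real \<Rightarrow> real" where
  "\<xi>_temp M D\<^sub>0 =
     (THE x. 0 < x \<and> F_temp M D\<^sub>0 x = \<l> M * sqrt pi / (D\<^sub>0 * c\<^sub>1 M) * G_temp M D\<^sub>0 x)"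

definition \<mu>_temp :: "stefan_data \<Rightarrow> real \<Rightarrow> real" where
  "\<mu>_temp M D\<^sub>0 = sqrt (\<alpha>\<^sub>1\<^sub>2 M) * W_temp M D\<^sub>0 (\<xi>_temp M D\<^sub>0)"

definition \<theta>1_temp :: "stefan_data \<Rightarrow> real \<Rightarrow> real \<Rightarrow> real \<Rightarrow> real" where
  "\<theta>1_temp M D\<^sub>0 x t = - D\<^sub>0 * (1 - erf (x / (2 * sqrt (\<alpha>\<^sub>1 M * t))) / erf (\<xi>_temp M D\<^sub>0))"

definition \<theta>2_temp :: "stefan_data \<Rightarrow> real \<Rightarrow> real \<Rightarrow> real \<Rightarrow> real" where
  "\<theta>2_temp M D\<^sub>0 x t =
     (let \<mu> = \<mu>_temp M D\<^sub>0 in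
       \<theta>\<^sub>0 M * erf \<mu> / erfc \<mu> * (erf (x / (2 * sqrt (\<alpha>\<^sub>2 M * t))) / erf \<mu> - 1))"

definition s_temp :: "stefan_data \<Rightarrow> real \<Rightarrow> real \<Rightarrow> real" where
  "s_temp M D\<^sub>0 t = 2 * \<xi>_temp M D\<^sub>0 * sqrt (\<alpha>\<^sub>1 M * t)"

definition r_temp :: "stefan_data \<Rightarrow> real \<Rightarrow> real \<Rightarrow> real" where
  "r_temp M D\<^sub>0 t = 2 * \<mu>_temp M D\<^sub>0 * sqrt (\<alpha>\<^sub>2 M * t)"

end

theory Submission
  imports Defs "HOL-Probability.Distributions" "HOL-Real_Asymp.Real_Asymp"
begin

text \<open>
  Both transcendental equations, for \<open>\<xi>\<close> and for \<open>\<xi>\<^sup>\<star>\<close>, say that a single function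
  \<open>stefan_balance M D K\<close> vanishes: \<open>K = k\<^sub>1 / (h\<^sub>0 sqrt (\<alpha>\<^sub>1 \<pi>))\<close>, \<open>D = Dinf\<close> for the convective
  problem and \<open>K = 0\<close>, \<open>D = D\<^sub>0\<close> for the temperature problem.  It is strictly decreasing, because
  \<open>exp (- x\<^sup>2) / erfc x\<close> is increasing (Mills' ratio), so it has at most one positive root;
  in the convective case the threshold condition makes it positive at \<open>0\<close>, and it is negative for large \<open>x\<close>, so a root exists.
  With the given \<open>D\<^sub>0\<close>, \<open>erf \<xi> / D\<^sub>0 = (erf \<xi> + K) / Dinf\<close>, so at \<open>\<xi>\<close> the two balances differ
  only by the factor \<open>Dinf / D\<^sub>0\<close>.  Hence \<open>\<xi>\<close> is the root for the temperature problem,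
  and all formulas agree.\<close>

section \<open>The error function\<close>

lemma has_real_derivative_erf:
  "(erf has_real_derivative 2 / sqrt pi * exp (- x\<^sup>2)) (at x)"
proof -
  \<comment> \<open>The interval contains \<open>0\<close> and has \<open>x\<close> in its interior,
    so negative \<open>x\<close> is covered as well and the derivative within it is the full
    derivative.\<close>
  define a b where "a = min 0 x - 1" and "b = max 0 x + 1"
  have le: "a \<le> 0" "0 \<le> b" "a < x" "x < b"
    by (auto simp: a_def b_def)
  have "continuous_on {a..b} (\<lambda>y::real. exp (- y\<^sup>2))"
    by (intro continuous_intros)
  from interval_integral_FTC2[OF le(1,2) this, of x]
  have "((\<lambda>u. LBINT y=ereal 0..ereal u. exp (- y\<^sup>2)) has_vector_derivative exp (- x\<^sup>2))
      (at x within {a..b})"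
    using le by simp
  moreover have "at x within {a..b} = at x"
    using le by (intro at_within_Icc_at)
  ultimately have "((\<lambda>u. LBINT y=ereal 0..ereal u. exp (- y\<^sup>2)) has_real_derivative exp (- x\<^sup>2)) (at x)"
    by (simp only: has_real_derivative_iff_has_vector_derivative)
  from DERIV_cmult[OF this, of "2 / sqrt pi"] show ?thesis
    unfolding erf_def [abs_def] .
qed

lemma has_real_derivative_erf_compose [derivative_intros]:
  assumes "(f has_real_derivative f') (at x within S)"
  shows "((\<lambda>x. erf (f x)) has_real_derivative (2 / sqrt pi * exp (- (f x)\<^sup>2)) * f') (at x within S)"
  using DERIV_chain2[OF has_real_derivative_erf assms] .

lemma has_real_derivative_erfc_compose [derivative_intros]:
  assumes "(f has_real_derivative f') (at x within S)"
  shows "((\<lambda>x. erfc (f x)) has_real_derivative - (2 / sqrt pi * exp (- (f x)\<^sup>2)) * f') (at x within S)"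
  unfolding erfc_def by (auto intro!: derivative_eq_intros assms)

lemma isCont_erf: "isCont erf x"
  using has_real_derivative_erf by (rule DERIV_isCont)

lemma continuous_on_erf [continuous_intros]:
  "continuous_on S f \<Longrightarrow> continuous_on S (\<lambda>x. erf (f x))"
  by (rule continuous_on_compose2[where t = UNIV])
     (auto intro!: continuous_at_imp_continuous_on isCont_erf)

lemma continuous_on_erfc [continuous_intros]:
  "continuous_on S f \<Longrightarrow> continuous_on S (\<lambda>x. erfc (f x))"
  unfolding erfc_def by (intro continuous_intros)

lemma erf_0 [simp]: "erf 0 = 0"
  by (simp add: erf_def)

text \<open>The normalising factor of \<open>erf\<close> is the reciprocal of the Gaussian integral
  over the half-line, which \<open>gaussian_moment_0\<close> supplies.\<close>

lemma tendsto_erf_at_top: "(erf \<longlongrightarrow> 1) at_top"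
proof -
  have int: "set_integrable lborel {0..} (\<lambda>y::real. exp (- y\<^sup>2))"
    and val: "(LBINT y:{0..}. exp (- y\<^sup>2)) = sqrt pi / 2"
    using gaussian_moment_0
    by (auto simp: has_bochner_integral_iff set_integrable_def set_lebesgue_integral_def)
  have "((\<lambda>b. LBINT y:{0..b}. exp (- y\<^sup>2)) \<longlongrightarrow> sqrt pi / 2) at_top"
    using tendsto_set_lebesgue_integral_at_top[OF _ int] by (simp add: val)
  then have "((\<lambda>b. 2 / sqrt pi * (LBINT y:{0..b}. exp (- y\<^sup>2))) \<longlongrightarrow> 2 / sqrt pi * (sqrt pi / 2)) at_top"
    by (intro tendsto_intros)
  moreover have "\<forall>\<^sub>F b in at_top. 2 / sqrt pi * (LBINT y:{0..b}. exp (- y\<^sup>2)) = erf b"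
    using eventually_ge_at_top[of 0]
    by eventually_elim (simp add: erf_def interval_integral_Icc)
  ultimately have "(erf \<longlongrightarrow> 2 / sqrt pi * (sqrt pi / 2)) at_top"
    by (rule Lim_transform_eventually)
  then show ?thesis by simp
qed

lemma tendsto_erfc_at_top: "(erfc \<longlongrightarrow> 0) at_top"
  using tendsto_diff[OF tendsto_const[of 1] tendsto_erf_at_top] by (simp add: erfc_def [abs_def])

lemma erf_strict_mono:
  assumes "x < y"
  shows "erf x < erf y"
  by (rule DERIV_pos_imp_increasing[OF assms]) (auto intro!: exI has_real_derivative_erf)

lemma erf_mono: "x \<le> y \<Longrightarrow> erf x \<le> erf y"
  using erf_strict_mono by (cases "x = y") (auto simp: less_le)

lemma erf_pos: "0 < x \<Longrightarrow> 0 < erf x"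
  using erf_strict_mono[of 0 x] by simp

lemma erf_nonneg: "0 \<le> x \<Longrightarrow> 0 \<le> erf x"
  using erf_mono[of 0 x] by simp

text \<open>\<open>erfc\<close> decreases on the whole line and tends to 0 at infinity.\<close>

lemma erfc_pos: "0 < erfc x"
proof (rule DERIV_neg_imp_decreasing_at_top[OF _ tendsto_erfc_at_top])
  fix u :: real
  have "(erfc has_real_derivative - (2 / sqrt pi * exp (- u\<^sup>2))) (at u)"
    using has_real_derivative_erfc_compose[OF DERIV_ident, of u UNIV] by simp
  then show "\<exists>y. (erfc has_real_derivative y) (at u) \<and> y < 0"
    by (intro exI conjI) auto
qed

text \<open>The right side minus the left tends to 0 at infinity and has the negative derivative
  \<open>- exp (- u\<^sup>2) / (u\<^sup>2 * sqrt pi)\<close>.\<close>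

lemma erfc_less_mills:
  assumes "0 < x"
  shows "erfc x < exp (- x\<^sup>2) / (x * sqrt pi)"
proof -
  let ?f = "\<lambda>x. exp (- x\<^sup>2) / (x * sqrt pi) - erfc x"
  have "0 < ?f x"
  proof (rule DERIV_neg_imp_decreasing_at_top[where f = ?f and b = x])
    fix u assume "x \<le> u"
    with assms have u: "0 < u" by simp
    have "(?f has_real_derivative
        ((- (2 * u)) * exp (- u\<^sup>2) * (u * sqrt pi) - exp (- u\<^sup>2) * sqrt pi) / (u * sqrt pi)\<^sup>2
          + 2 / sqrt pi * exp (- u\<^sup>2)) (at u)"
      using u by (auto intro!: derivative_eq_intros simp: power2_eq_square)
    moreover have "((- (2 * u)) * exp (- u\<^sup>2) * (u * sqrt pi) - exp (- u\<^sup>2) * sqrt pi) / (u * sqrt pi)\<^sup>2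
          + 2 / sqrt pi * exp (- u\<^sup>2) = - exp (- u\<^sup>2) / (u\<^sup>2 * sqrt pi)"
    proof -
      have "((- (2 * u)) * g * (u * w) - g * w) / (u * w)\<^sup>2 + 2 / w * g = - g / (u\<^sup>2 * w)"
        if "0 < w" for g w :: real
        using u that by (simp add: field_simps power2_eq_square)
      then show ?thesis by simp
    qed
    ultimately show "\<exists>y. (?f has_real_derivative y) (at u) \<and> y < 0"
      using u by (intro exI[of _ "- exp (- u\<^sup>2) / (u\<^sup>2 * sqrt pi)"]) (auto simp: divide_neg_pos)
  next
    have "((\<lambda>x. exp (- x\<^sup>2) / (x * sqrt pi)) \<longlongrightarrow> 0) at_top"
      by real_asymp
    from tendsto_diff[OF this tendsto_erfc_at_top]
    show "(?f \<longlongrightarrow> 0) at_top" by simp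
  qed
  then show ?thesis by simp
qed

text \<open>Up to a constant factor, the reciprocal of Mills' ratio of the standard normal
  distribution at \<open>sqrt 2 * x\<close>.\<close>

definition mills :: "real \<Rightarrow> real" where
  "mills x = exp (- x\<^sup>2) / erfc x"

lemma mills_pos: "0 < mills x"
  by (simp add: mills_def erfc_pos)

lemma continuous_on_mills [continuous_intros]:
  "continuous_on S f \<Longrightarrow> continuous_on S (\<lambda>x. mills (f x))"
  unfolding mills_def using erfc_pos by (intro continuous_intros) (auto simp: less_le)

text \<open>The derivative is a positive multiple of the gap in \<open>erfc_less_mills\<close>. That
  bound requires \<open>0 < u\<close>; the criterion on the open interval still admits the left end
  \<open>x = 0\<close>.\<close>

lemma mills_strict_mono:
  assumes "0 \<le> x" "x < y"
  shows "mills x < mills y"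
proof (rule DERIV_pos_imp_increasing_open[OF \<open>x < y\<close>])
  fix u assume "x < u" "u < y"
  with assms have u: "0 < u" by simp
  have nz: "erfc u \<noteq> 0" using erfc_pos[of u] by simp
  have "(mills has_real_derivative
      (2 * exp (- u\<^sup>2) * u / (erfc u)\<^sup>2) * (exp (- u\<^sup>2) / (u * sqrt pi) - erfc u)) (at u)"
    unfolding mills_def [abs_def] using u nz
    by (auto intro!: derivative_eq_intros simp: field_simps power2_eq_square)
  moreover have "0 < (2 * exp (- u\<^sup>2) * u / (erfc u)\<^sup>2) * (exp (- u\<^sup>2) / (u * sqrt pi) - erfc u)"
    using u nz erfc_less_mills[OF u] by (intro mult_pos_pos divide_pos_pos) auto
  ultimately show "\<exists>v. (mills has_real_derivative v) (at u) \<and> 0 < v" by blast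
qed (intro continuous_intros)

lemma mills_mono: "0 \<le> x \<Longrightarrow> x \<le> y \<Longrightarrow> mills x \<le> mills y"
  using mills_strict_mono by (cases "x = y") (auto simp: less_le)

section \<open>The transcendental equations\<close>

text \<open>Each of the three terms is monotone on the positive axis, the \<open>mills\<close> term
  strictly. This yields uniqueness of the zero \<eta> and later the sign of \<open>F\<^sub>3\<close>
  to the left of it.\<close>

lemma threshold_function_strict_mono:
  assumes "admissible M" "0 < x" "x < y"
  shows "F\<^sub>3 M x < F\<^sub>3 M y"
proof -
  have "mills x < mills y"
    using assms by (intro mills_strict_mono) auto
  moreover have "\<gamma> M * k\<^sub>1 M * sqrt pi / (2 * \<theta>\<^sub>0 M * k\<^sub>2 M) * (1 / y)
      \<le> \<gamma> M * k\<^sub>1 M * sqrt pi / (2 * \<theta>\<^sub>0 M * k\<^sub>2 M) * (1 / x)"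
    using assms by (intro mult_left_mono divide_left_mono) (auto simp: admissible_def)
  moreover have "(1 - \<epsilon> M) * \<l> M * sqrt pi / (\<theta>\<^sub>0 M * c\<^sub>2 M) * x
      \<le> (1 - \<epsilon> M) * \<l> M * sqrt pi / (\<theta>\<^sub>0 M * c\<^sub>2 M) * y"
    using assms by (intro mult_left_mono) (auto simp: admissible_def)
  ultimately show ?thesis by (simp add: F\<^sub>3_def mills_def)
qed

text \<open>As \<eta> is a definite description, existence and uniqueness of the zero have to be
  shown first. Existence is by intermediate values: the pole dominates near 0, the linear term far
  out.\<close>

lemma threshold_zero:
  assumes "admissible M"
  shows "0 < \<eta> M" "F\<^sub>3 M (\<eta> M) = 0"
proof -
  define C where "C = \<gamma> M * k\<^sub>1 M * sqrt pi / (2 * \<theta>\<^sub>0 M * k\<^sub>2 M)"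
  define B where "B = (1 - \<epsilon> M) * \<l> M * sqrt pi / (\<theta>\<^sub>0 M * c\<^sub>2 M)"
  have C: "0 < C" and B: "0 < B"
    using assms by (auto simp: C_def B_def admissible_def)
  have F: "F\<^sub>3 M = (\<lambda>x. mills x - C * (1 / x) + B * x)"
    by (simp add: fun_eq_iff F\<^sub>3_def mills_def C_def B_def)
  define m where "m = mills 1"
  have m: "0 < m" by (simp add: m_def mills_pos)
  \<comment> \<open>On \<open>(0, 1]\<close> the terms other than the pole add up to at most
    \<open>m + B\<close>, which \<open>C / p\<close> outweighs. Beyond 1 the pole term is at most
    \<open>C\<close>, which \<open>B * q\<close> outweighs.\<close>
  define p where "p = min 1 (C / (m + B))"
  define q where "q = 1 + C / B"
  have p: "0 < p" "p \<le> 1" "p \<le> C / (m + B)" and q: "1 \<le> q" "p \<le> q"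
    using C B m by (auto simp: p_def q_def intro: min.coboundedI1)
  have "F\<^sub>3 M p \<le> 0"
  proof -
    have "mills p \<le> m" using p by (auto simp: m_def intro: mills_mono)
    moreover have "B * p \<le> B" using p B by simp
    moreover have "m + B \<le> C * (1 / p)"
      using p C B m by (simp add: field_simps)
    ultimately show ?thesis by (simp add: F)
  qed
  moreover have "0 \<le> F\<^sub>3 M q"
  proof -
    have "C * (1 / q) \<le> C" using q C by (simp add: field_simps)
    moreover have "C \<le> B * q" using B by (simp add: q_def field_simps)
    ultimately show ?thesis using mills_pos[of q] by (simp add: F)
  qed
  moreover have "continuous_on {p..q} (F\<^sub>3 M)"
    unfolding F using p by (intro continuous_intros) auto
  ultimately obtain x where "p \<le> x" "F\<^sub>3 M x = 0"
    using IVT'[of "F\<^sub>3 M" p 0 q] q by auto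
  then have "\<exists>!x. 0 < x \<and> F\<^sub>3 M x = 0"
  proof (intro ex1I[of _ x] conjI)
    fix y assume "0 < y \<and> F\<^sub>3 M y = 0"
    then show "y = x"
      using p \<open>p \<le> x\<close> \<open>F\<^sub>3 M x = 0\<close> threshold_function_strict_mono[OF assms, of x y]
        threshold_function_strict_mono[OF assms, of y x] by (cases x y rule: linorder_cases) auto
  qed (use p in auto)
  from theI'[OF this] show "0 < \<eta> M" "F\<^sub>3 M (\<eta> M) = 0"
    by (auto simp: \<eta>_def)
qed

text \<open>Abstracting the constants lets monotonicity and existence be argued from signs alone.
  The argument of \<open>mills\<close> is the scaled \<open>W\<close>, and the last bracket is
  \<open>G\<close>; both contain the same increasing function
  \<open>exp (x\<^sup>2) * (erf x + K)\<close>.\<close>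

definition balance :: "real \<Rightarrow> real \<Rightarrow> real \<Rightarrow> real \<Rightarrow> real \<Rightarrow> real \<Rightarrow> real \<Rightarrow> real" where
  "balance K A b C B C' x =
     exp (- x\<^sup>2) / (erf x + K) - A * mills (b * (x + C * (exp (x\<^sup>2) * (erf x + K))))
     - B * (x + C' * (exp (x\<^sup>2) * (erf x + K)))"

text \<open>The first term decreases, and the subtracted ones increase. Strictness comes from the
  summand \<open>B * x\<close>, hence \<open>0 < B\<close>.\<close>

lemma balance_strict_antimono:
  assumes nonneg: "0 \<le> K" "0 \<le> A" "0 \<le> b" "0 \<le> C" "0 \<le> C'" and "0 < B"
    and xy: "0 < x" "x < y"
  shows "balance K A b C B C' y < balance K A b C B C' x"
proof -
  let ?g = "\<lambda>x. exp (x\<^sup>2) * (erf x + K)"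
  have E: "0 < erf x + K" "erf x + K \<le> erf y + K"
    using erf_pos[of x] erf_mono[of x y] assms by auto
  have sq: "x\<^sup>2 \<le> y\<^sup>2" using xy by (intro power_mono) auto
  have g: "?g x \<le> ?g y" "0 \<le> ?g x"
    using E sq by (auto intro!: mult_mono)
  have "exp (- y\<^sup>2) / (erf y + K) \<le> exp (- x\<^sup>2) / (erf x + K)"
    using E sq by (intro frac_le) auto
  moreover have "A * mills (b * (x + C * ?g x)) \<le> A * mills (b * (y + C * ?g y))"
    using nonneg xy g erf_nonneg[of x] by (intro mult_left_mono mills_mono add_mono mult_nonneg_nonneg add_nonneg_nonneg) auto
  moreover have "B * (x + C' * ?g x) < B * (y + C' * ?g y)"
    using \<open>0 < B\<close> nonneg xy g by (intro mult_strict_left_mono add_less_le_mono mult_left_mono) auto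
  ultimately show ?thesis by (simp add: balance_def)
qed

lemma balance_root_unique:
  assumes "0 \<le> K" "0 \<le> A" "0 \<le> b" "0 \<le> C" "0 \<le> C'" "0 < B"
    and "0 < x" "balance K A b C B C' x = 0" "0 < y" "balance K A b C B C' y = 0"
  shows "x = y"
  using balance_strict_antimono[OF assms(1-6), of x y]
    balance_strict_antimono[OF assms(1-6), of y x] assms
  by (cases x y rule: linorder_cases) auto

text \<open>Intermediate values on \<open>{0..q}\<close>. With \<open>0 < K\<close> the first term
  has no pole at 0 and stays below \<open>1 / K\<close>, so the linear term overtakes it.\<close>

lemma balance_root_exists:
  assumes "0 < K" "0 \<le> A" "0 \<le> C'" "0 < B"
    and "0 < balance K A b C B C' 0"
  shows "\<exists>x>0. balance K A b C B C' x = 0"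
proof -
  \<comment> \<open>Chosen so that \<open>B * q\<close> equals \<open>1 / K\<close>, the bound of
    the first term.\<close>
  define q where "q = 1 / (K * B)"
  have q: "0 < q" using assms by (simp add: q_def)
  have E: "K \<le> erf x + K" if "0 \<le> x" for x using erf_nonneg[OF that] by simp
  have "balance K A b C B C' q \<le> 0"
  proof -
    have "exp (- q\<^sup>2) / (erf q + K) \<le> 1 / K"
      using E[of q] q assms by (intro frac_le) auto
    moreover have "0 \<le> A * mills (b * (q + C * (exp (q\<^sup>2) * (erf q + K))))"
      using assms mills_pos by (intro mult_nonneg_nonneg) (auto intro: less_imp_le)
    moreover have "1 / K \<le> B * (q + C' * (exp (q\<^sup>2) * (erf q + K)))"
    proof -
      have "1 / K = B * q" using assms by (simp add: q_def)
      also have "\<dots> \<le> B * (q + C' * (exp (q\<^sup>2) * (erf q + K)))"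
        using E[of q] q assms by (intro mult_left_mono) auto
      finally show ?thesis .
    qed
    ultimately show ?thesis by (simp add: balance_def)
  qed
  moreover have "continuous_on {0..q} (balance K A b C B C')"
  proof -
    have "erf x + K \<noteq> 0" if "x \<in> {0..q}" for x
      using E[of x] that assms by auto
    then show ?thesis
      unfolding balance_def by (intro continuous_intros) auto
  qed
  ultimately obtain x where "0 \<le> x" "balance K A b C B C' x = 0"
    using IVT2'[of "balance K A b C B C'" q 0 0] q assms by auto
  moreover from this have "x \<noteq> 0" using assms(5) by auto
  ultimately show ?thesis by (intro exI[of _ x]) auto
qed

section \<open>The balance with the material constants inserted\<close>

lemma sqrt_diffusivities:
  assumes "admissible M"
  shows "sqrt (\<alpha>\<^sub>1 M) = sqrt (k\<^sub>1 M) / (sqrt (\<rho> M) * sqrt (c\<^sub>1 M))"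
    and "sqrt (\<alpha>\<^sub>2 M) = sqrt (k\<^sub>2 M) / (sqrt (\<rho> M) * sqrt (c\<^sub>2 M))"
    and "sqrt (\<alpha>\<^sub>1\<^sub>2 M) = sqrt (k\<^sub>1 M) * sqrt (c\<^sub>2 M) / (sqrt (c\<^sub>1 M) * sqrt (k\<^sub>2 M))"
  using assms
  by (auto simp: \<alpha>\<^sub>1\<^sub>2_def \<alpha>\<^sub>1_def \<alpha>\<^sub>2_def real_sqrt_divide real_sqrt_mult admissible_def)

lemma diffusivities_pos:
  assumes "admissible M"
  shows "0 < \<alpha>\<^sub>1 M" "0 < \<alpha>\<^sub>2 M" "0 < \<alpha>\<^sub>1\<^sub>2 M"
  using assms by (auto simp: \<alpha>\<^sub>1\<^sub>2_def \<alpha>\<^sub>1_def \<alpha>\<^sub>2_def admissible_def)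

definition convective_resistance :: "stefan_data \<Rightarrow> real \<Rightarrow> real" where
  "convective_resistance M h\<^sub>0 = k\<^sub>1 M / (h\<^sub>0 * sqrt (\<alpha>\<^sub>1 M * pi))"

lemma convective_resistance_pos:
  "admissible M \<Longrightarrow> 0 < h\<^sub>0 \<Longrightarrow> 0 < convective_resistance M h\<^sub>0"
  using diffusivities_pos[of M] by (auto simp: convective_resistance_def admissible_def)

definition stefan_balance :: "stefan_data \<Rightarrow> real \<Rightarrow> real \<Rightarrow> real \<Rightarrow> real" where
  "stefan_balance M D K =
     balance K (\<theta>\<^sub>0 M * sqrt (k\<^sub>2 M * c\<^sub>2 M) / (D * sqrt (k\<^sub>1 M * c\<^sub>1 M))) (sqrt (\<alpha>\<^sub>1\<^sub>2 M))
       (\<gamma> M * sqrt pi / (2 * D)) (\<l> M * sqrt pi / (D * c\<^sub>1 M)) ((1 - \<epsilon> M) * \<gamma> M * sqrt pi / (2 * D))"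

lemma stefan_balance_root_unique:
  assumes "admissible M" "0 < D" "0 \<le> K"
    and "0 < x" "stefan_balance M D K x = 0" "0 < y" "stefan_balance M D K y = 0"
  shows "x = y"
  \<comment> \<open>The placeholders are the sign conditions on the coefficients, which follow from
    \<open>admissible M\<close>.\<close>
  using assms(3) _ _ _ _ _ assms(4-7) unfolding stefan_balance_def
  by (rule balance_root_unique)
     (use assms diffusivities_pos[of M] in \<open>auto simp: admissible_def\<close>)

lemma F_conv_eq_iff:
  assumes "admissible M"
  shows "F_conv M D h\<^sub>0 x = \<l> M * sqrt pi / (D * c\<^sub>1 M) * G_conv M D h\<^sub>0 x
    \<longleftrightarrow> stefan_balance M D (convective_resistance M h\<^sub>0) x = 0"
  using diffusivities_pos[OF assms]
  by (simp add: F_conv_def G_conv_def W_conv_def stefan_balance_def balance_def mills_def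
      convective_resistance_def power_mult_distrib mult.assoc)

lemma F_temp_eq_iff:
  assumes "admissible M"
  shows "F_temp M D x = \<l> M * sqrt pi / (D * c\<^sub>1 M) * G_temp M D x \<longleftrightarrow> stefan_balance M D 0 x = 0"
  using diffusivities_pos[OF assms]
  by (simp add: F_temp_def G_temp_def W_temp_def stefan_balance_def balance_def mills_def
      power_mult_distrib mult.assoc)

text \<open>At the origin the balance is, up to a positive factor, \<open>- F\<^sub>3 z\<close> at
  \<open>z = \<gamma> k\<^sub>1 / (2 Dinf h\<^sub>0 sqrt \<alpha>\<^sub>2)\<close>, and the threshold condition says \<open>z < \<eta>\<close>.\<close>

lemma stefan_balance_0_pos:
  assumes adm: "admissible M" and D: "0 < D" and h: "0 < h\<^sub>0" and thr: "h_threshold M D < h\<^sub>0"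
  shows "0 < stefan_balance M D (convective_resistance M h\<^sub>0) 0"
proof -
  \<comment> \<open>In terms of the square roots of the data the identities below are rational and
    within reach of \<open>field_simps\<close>.\<close>
  define a b c d R w where roots: "a = sqrt (k\<^sub>1 M)" "b = sqrt (k\<^sub>2 M)" "c = sqrt (c\<^sub>1 M)"
    "d = sqrt (c\<^sub>2 M)" "R = sqrt (\<rho> M)" "w = sqrt pi"
  have pos: "0 < a" "0 < b" "0 < c" "0 < d" "0 < R" "0 < w" "0 < \<theta>\<^sub>0 M" "0 < \<gamma> M"
    and sq: "k\<^sub>1 M = a * a" "k\<^sub>2 M = b * b" "c\<^sub>1 M = c * c" "c\<^sub>2 M = d * d"
    using adm by (auto simp: roots admissible_def)
  note sqrts = sqrt_diffusivities[OF adm, folded roots]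
  define K where "K = convective_resistance M h\<^sub>0"
  have K: "0 < K" using convective_resistance_pos[OF adm h] by (simp add: K_def)
  have K_eq: "K = a * R * c / (h\<^sub>0 * w)"
    unfolding K_def convective_resistance_def
    using pos h by (simp add: real_sqrt_mult sqrts roots(6)[symmetric] sq field_simps)
  \<comment> \<open>\<open>A\<close> and \<open>z\<close> are the coefficient and the argument of
    \<open>mills\<close> in the balance at 0; \<open>K_eq\<close> brings \<open>z\<close> into the
    form compared with the threshold.\<close>
  define A where "A = \<theta>\<^sub>0 M * (b * d) / (D * (a * c))"
  define z where "z = a * d / (c * b) * (\<gamma> M * w / (2 * D) * K)"
  have A: "0 < A" and z: "0 < z"
    using pos D K by (auto simp: A_def z_def)
  have "z < \<eta> M"
  proof -
    have "\<gamma> M * (a * a) / (2 * D * \<eta> M * (b / (R * d))) < h\<^sub>0"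
      using thr by (simp add: h_threshold_def sqrts sq)
    then have "\<gamma> M * (a * a) * (R * d) < h\<^sub>0 * (2 * D * \<eta> M * b)"
      using pos D threshold_zero(1)[OF adm] by (simp add: field_simps)
    then show ?thesis
      using pos D h by (simp add: z_def K_eq field_simps)
  qed
  then have "F\<^sub>3 M z < 0"
    using threshold_function_strict_mono[OF adm z \<open>z < \<eta> M\<close>] threshold_zero(2)[OF adm] by simp
  then have "0 < - (A * F\<^sub>3 M z)"
    using A by (simp add: mult_pos_neg)
  \<comment> \<open>Multiplied by \<open>A\<close>, the pole term of \<open>F\<^sub>3\<close>
    becomes the first term of the balance at 0, and the linear term becomes the contribution of
    \<open>G_conv\<close>.\<close>
  also have "- (A * F\<^sub>3 M z) = 1 / K - A * mills z
      - \<l> M * w / (D * (c * c)) * ((1 - \<epsilon> M) * \<gamma> M * w / (2 * D) * K)"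
  proof -
    have "A * (\<gamma> M * k\<^sub>1 M * w / (2 * \<theta>\<^sub>0 M * k\<^sub>2 M) * (1 / z)) = 1 / K"
      using pos D K by (simp add: A_def z_def sq field_simps)
    moreover have "A * ((1 - \<epsilon> M) * \<l> M * w / (\<theta>\<^sub>0 M * c\<^sub>2 M) * z)
        = \<l> M * w / (D * (c * c)) * ((1 - \<epsilon> M) * \<gamma> M * w / (2 * D) * K)"
      using pos D K by (simp add: A_def z_def sq ac_simps)
    moreover have "F\<^sub>3 M z = mills z - \<gamma> M * k\<^sub>1 M * w / (2 * \<theta>\<^sub>0 M * k\<^sub>2 M) * (1 / z)
        + (1 - \<epsilon> M) * \<l> M * w / (\<theta>\<^sub>0 M * c\<^sub>2 M) * z"
      by (simp add: F\<^sub>3_def mills_def roots)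
    ultimately show ?thesis by (simp only: distrib_left right_diff_distrib)
  qed
  also have "\<dots> = stefan_balance M D K 0"
    by (simp add: stefan_balance_def balance_def A_def z_def sqrts real_sqrt_mult
        flip: roots) (simp add: sq)
  finally show ?thesis by (simp add: K_def)
qed

lemma \<xi>_conv_root:
  assumes "admissible M" "0 < D" "0 < h\<^sub>0" "h_threshold M D < h\<^sub>0"
  shows "0 < \<xi>_conv M D h\<^sub>0" "stefan_balance M D (convective_resistance M h\<^sub>0) (\<xi>_conv M D h\<^sub>0) = 0"
proof -
  let ?K = "convective_resistance M h\<^sub>0"
  have K: "0 < ?K" by (rule convective_resistance_pos) fact+
  have "\<exists>x>0. stefan_balance M D ?K x = 0"
    using stefan_balance_0_pos[OF assms] unfolding stefan_balance_def
    by (intro balance_root_exists) (use assms K in \<open>auto simp: admissible_def\<close>)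
  then have "\<exists>!x. 0 < x \<and> stefan_balance M D ?K x = 0"
    using stefan_balance_root_unique[OF assms(1,2) less_imp_le[OF K]] by blast
  from theI'[OF this] show "0 < \<xi>_conv M D h\<^sub>0" "stefan_balance M D ?K (\<xi>_conv M D h\<^sub>0) = 0"
    unfolding \<xi>_conv_def F_conv_eq_iff[OF assms(1)] by auto
qed

text \<open>By uniqueness, any positive root exhibited is the one described; the convective root
  will serve as this witness.\<close>

lemma \<xi>_temp_eqI:
  assumes "admissible M" "0 < D" "0 < x" "stefan_balance M D 0 x = 0"
  shows "\<xi>_temp M D = x"
  unfolding \<xi>_temp_def F_temp_eq_iff[OF assms(1)]
  using assms stefan_balance_root_unique[OF assms(1,2)] by (intro the_equality) auto

text \<open>\<open>W\<close> and \<open>G\<close> depend on the problem only through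
  \<open>(erf x + K) / D\<close>, which the choice of \<open>D\<^sub>0\<close> preserves.
  Multiplying each balance by its own constant also equalises the first terms and cancels the
  factors \<open>1 / D\<close> of the others.\<close>

lemma stefan_balance_rescale:
  assumes "0 < D" "0 < x" "0 \<le> K" and D\<^sub>0: "D\<^sub>0 = D * erf x / (erf x + K)"
  shows "D\<^sub>0 * stefan_balance M D\<^sub>0 0 x = D * stefan_balance M D K x"
proof -
  define E e where "E = erf x" and "e = exp (x\<^sup>2)"
  have E: "0 < E" "0 < E + K" using erf_pos[of x] assms by (auto simp: E_def)
  have D0: "0 < D\<^sub>0" using E assms by (simp add: D\<^sub>0 E_def)
  have ratio: "1 / D\<^sub>0 * (e * E) = 1 / D * (e * (E + K))"
    using E assms(1) by (simp add: D\<^sub>0 E_def)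
  have "u / D\<^sub>0 * (e * E) = u / D * (e * (E + K))" "u / (2 * D\<^sub>0) * (e * E) = u / (2 * D) * (e * (E + K))" for u
    using arg_cong[OF ratio, of "\<lambda>v. u * v"] arg_cong[OF ratio, of "\<lambda>v. u / 2 * v"] by (simp_all add: ac_simps)
  moreover have "D\<^sub>0 * (y / E) = D * (y / (E + K))" for y
    using E by (simp add: D\<^sub>0 E_def)
  ultimately show ?thesis
    using D0 assms(1)
    unfolding stefan_balance_def balance_def E_def [symmetric] e_def [symmetric]
    by (simp add: right_diff_distrib)
qed

section \<open>Similarity solutions\<close>

text \<open>A self-similar solution of the heat equation; the temperatures of both phases are
  instances.\<close>

definition profile :: "real \<Rightarrow> real \<Rightarrow> real \<Rightarrow> real \<Rightarrow> real \<Rightarrow> real" where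
  "profile a A B x t = A + B * erf (x / (2 * sqrt (a * t)))"

lemma has_real_derivative_profile:
  assumes "0 < a" "0 < t"
  shows "((\<lambda>x. profile a A B x t) has_real_derivative
    B * exp (- (x / (2 * sqrt (a * t)))\<^sup>2) / (sqrt pi * sqrt (a * t))) (at x within S)"
proof -
  have "((\<lambda>x. A + B * erf (x / (2 * q))) has_real_derivative
      B * exp (- (x / (2 * q))\<^sup>2) / (sqrt pi * q)) (at x within S)" if "0 < q" for q
    using that by (auto intro!: derivative_eq_intros)
  then show ?thesis using assms by (simp add: profile_def)
qed

text \<open>With \<open>q = sqrt (a * t)\<close> and the Gaussian factor \<open>E\<close>, both
  sides of the heat equation equal \<open>E * (- a * x / (2 * q ^ 3))\<close>.\<close>

lemma heat_eq_at_profile: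
  assumes "0 < a" "0 < t"
  shows "heat_eq_at a (profile a A B) x t"
proof -
  define q where "q = sqrt (a * t)"
  have q: "0 < q" using assms by (simp add: q_def)
  define E where "E = B * exp (- (x / (2 * q))\<^sup>2) / sqrt pi"
  have "((\<lambda>x. B * exp (- (x / (2 * q))\<^sup>2) / (sqrt pi * q)) has_real_derivative
      E * (- x / (2 * q ^ 3))) (at x)"
    using q by (auto intro!: derivative_eq_intros simp: E_def field_simps power2_eq_square power3_eq_cube)
  moreover have "((\<lambda>t. profile a A B x t) has_real_derivative E * (- a * x / (2 * q ^ 3))) (at t)"
  proof -
    have "((\<lambda>t. 2 * sqrt (a * t)) has_real_derivative a / q) (at t)"
      using assms by (auto intro!: derivative_eq_intros simp: mult_less_0_iff q_def field_simps)
    then have "((\<lambda>t. x / (2 * sqrt (a * t))) has_real_derivative - (x * (a / q)) / (2 * q)\<^sup>2) (at t)"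
      using q by (auto intro!: derivative_eq_intros simp: q_def power2_eq_square field_simps)
    from DERIV_add[OF DERIV_const DERIV_cmult[OF has_real_derivative_erf_compose[OF this, folded q_def]]]
    have "((\<lambda>t. A + B * erf (x / (2 * sqrt (a * t)))) has_real_derivative
        B * (2 / sqrt pi * exp (- (x / (2 * q))\<^sup>2) * (- (x * (a / q)) / (2 * q)\<^sup>2))) (at t)"
      by (simp only: add_0_left)
    moreover have "B * (2 / sqrt pi * exp (- (x / (2 * q))\<^sup>2) * (- (x * (a / q)) / (2 * q)\<^sup>2))
        = E * (- a * x / (2 * q ^ 3))"
      using q by (simp add: E_def power2_eq_square power3_eq_cube ac_simps)
    ultimately show ?thesis by (simp add: profile_def)
  qed
  ultimately show ?thesis
    unfolding heat_eq_at_def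
    using has_real_derivative_profile[OF assms, of A B, folded q_def]
    by (intro exI[of _ "\<lambda>x. B * exp (- (x / (2 * q))\<^sup>2) / (sqrt pi * q)"]
        exI[of _ "E * (- x / (2 * q ^ 3))"] exI[of _ "E * (- a * x / (2 * q ^ 3))"] conjI) auto
qed

lemma tendsto_profile_at_top:
  assumes "0 < a" "0 < t"
  shows "((\<lambda>x. profile a A B x t) \<longlongrightarrow> A + B) at_top"
proof -
  have "filterlim (\<lambda>x. x / (2 * q)) at_top at_top" if "0 < q" for q :: real
    using that by real_asymp
  then have "filterlim (\<lambda>x. x / (2 * sqrt (a * t))) at_top at_top"
    using assms by simp
  from filterlim_compose[OF tendsto_erf_at_top this]
  have "((\<lambda>x. A + B * erf (x / (2 * sqrt (a * t)))) \<longlongrightarrow> A + B * 1) at_top"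
    by (intro tendsto_intros)
  then show ?thesis by (simp add: profile_def)
qed

text \<open>As for large \<open>x\<close>, the similarity variable tends to infinity, so the initial
  condition and the condition at infinity impose the same relation on \<open>A + B\<close>.\<close>

lemma tendsto_profile_at_right_0:
  assumes "0 < a" "0 < x"
  shows "((\<lambda>t. profile a A B x t) \<longlongrightarrow> A + B) (at_right 0)"
proof -
  have "filterlim (\<lambda>t. x / (2 * sqrt (a * t))) at_top (at_right 0)" using assms by real_asymp
  from filterlim_compose[OF tendsto_erf_at_top this]
  have "((\<lambda>t. A + B * erf (x / (2 * sqrt (a * t)))) \<longlongrightarrow> A + B * 1) (at_right 0)"
    by (intro tendsto_intros)
  then show ?thesis by (simp add: profile_def)
qed

lemma has_real_derivative_sqrt_scaled:
  assumes "0 < a" "0 < t"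
  shows "((\<lambda>t. 2 * x * sqrt (a * t)) has_real_derivative x * sqrt a / sqrt t) (at t)"
proof -
  have "((\<lambda>t. 2 * x * sqrt (a * t)) has_real_derivative 2 * x * (a / (2 * sqrt (a * t)))) (at t)"
    using assms by (auto intro!: derivative_eq_intros simp: mult_less_0_iff field_simps)
  moreover have "2 * x * (a / (2 * sqrt (a * t))) = x * sqrt a / sqrt t"
    using assms by (simp add: real_sqrt_mult field_simps)
  ultimately show ?thesis by simp
qed

section \<open>Verification of the common equations\<close>

context
  fixes M :: stefan_data and D x m :: real
  assumes adm: "admissible M" and D_pos: "0 < D" and x_pos: "0 < x"
    and root: "stefan_balance M D 0 x = 0"
    and m_def: "m = sqrt (\<alpha>\<^sub>1\<^sub>2 M) * W_temp M D x"
begin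

lemma W_temp_pos: "0 < W_temp M D x"
  using adm D_pos x_pos erf_pos[OF x_pos]
  by (auto simp: W_temp_def admissible_def intro!: add_pos_pos mult_pos_pos)

lemma m_pos: "0 < m"
  using W_temp_pos diffusivities_pos[OF adm] by (simp add: m_def)

text \<open>The heat equations and limits are those of \<open>profile\<close>. At the free
  boundaries, the flux condition is a multiple of \<open>root\<close>, and the condition involving
  \<gamma> holds by the form of \<open>W_temp\<close>.\<close>

lemma common_equations_profile:
  "common_equations M (profile (\<alpha>\<^sub>1 M) (- D) (D / erf x))
     (profile (\<alpha>\<^sub>2 M) (- (\<theta>\<^sub>0 M * erf m / erfc m)) (\<theta>\<^sub>0 M / erfc m))
     (\<lambda>t. 2 * x * sqrt (\<alpha>\<^sub>1 M * t)) (\<lambda>t. 2 * m * sqrt (\<alpha>\<^sub>2 M * t))"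
    (is "common_equations M ?u ?v ?s ?r")
proof -
  have al: "0 < \<alpha>\<^sub>1 M" "0 < \<alpha>\<^sub>2 M" using diffusivities_pos[OF adm] by auto
  have E: "0 < erf x" "0 < erf m" "0 < erfc m"
    using erf_pos x_pos m_pos erfc_pos by auto
  have far: "- (\<theta>\<^sub>0 M * erf m / erfc m) + \<theta>\<^sub>0 M / erfc m = \<theta>\<^sub>0 M"
    using E by (simp add: field_simps) (simp add: erfc_def algebra_simps)
  have interface: "\<exists>u' v' s' r'.
        ((\<lambda>y. ?u y t) has_real_derivative u') (at (?s t) within {0..?s t}) \<and>
        ((\<lambda>y. ?v y t) has_real_derivative v') (at (?r t) within {?r t..}) \<and>
        (?s has_real_derivative s') (at t) \<and>
        (?r has_real_derivative r') (at t) \<and>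
        k\<^sub>1 M * u' - k\<^sub>2 M * v' = \<rho> M * \<l> M * (\<epsilon> M * s' + (1 - \<epsilon> M) * r') \<and>
        u' * (?r t - ?s t) = \<gamma> M" if t: "0 < t" for t
  proof -
    define a b c d R w T where roots: "a = sqrt (k\<^sub>1 M)" "b = sqrt (k\<^sub>2 M)" "c = sqrt (c\<^sub>1 M)"
      "d = sqrt (c\<^sub>2 M)" "R = sqrt (\<rho> M)" "w = sqrt pi" "T = sqrt t"
    have pos: "0 < a" "0 < b" "0 < c" "0 < d" "0 < R" "0 < w" "0 < T"
      and sq: "k\<^sub>1 M = a * a" "k\<^sub>2 M = b * b" "c\<^sub>1 M = c * c" "c\<^sub>2 M = d * d" "\<rho> M = R * R"
      using adm t by (auto simp: roots admissible_def)
    note sqrts = sqrt_diffusivities[OF adm, folded roots]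
    have arg: "?s t / (2 * sqrt (\<alpha>\<^sub>1 M * t)) = x" "?r t / (2 * sqrt (\<alpha>\<^sub>2 M * t)) = m"
      using al t by auto
    define e E where "e = exp (- x\<^sup>2)" and "E = erf x"
    have eE: "0 < e" "0 < E" using E by (auto simp: e_def E_def)
    \<comment> \<open>Writing \<open>exp (x\<^sup>2) * erf x\<close> as the quotient
      \<open>E / e\<close> lets it cancel against the gradient \<open>u'\<close>.\<close>
    define W where "W = x + \<gamma> M * w / (2 * D) * (E / e)"
    have ratio: "E / e = exp (x\<^sup>2) * erf x"
      by (simp add: e_def E_def exp_minus field_simps)
    have W: "W_temp M D x = W"
      by (simp add: W_temp_def W_def ratio roots)
    \<comment> \<open>This is \<open>G_temp\<close> at \<open>x\<close>, as the convex combination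
      in which the two boundary velocities enter the latent heat.\<close>
    define G where "G = \<epsilon> M * x + (1 - \<epsilon> M) * W"
    define u' where "u' = D / E * e / (w * (a / (R * c) * T))"
    define v' where "v' = \<theta>\<^sub>0 M * mills m / (w * (b / (R * d) * T))"
    have u: "((\<lambda>y. ?u y t) has_real_derivative u') (at (?s t) within {0..?s t})"
      using has_real_derivative_profile[OF al(1) t, of "- D" "D / erf x" "?s t", unfolded arg]
      by (simp add: u'_def e_def E_def real_sqrt_mult sqrts flip: roots)
    have v: "((\<lambda>y. ?v y t) has_real_derivative v') (at (?r t) within {?r t..})"
      using has_real_derivative_profile[OF al(2) t, of "- (\<theta>\<^sub>0 M * erf m / erfc m)" "\<theta>\<^sub>0 M / erfc m" "?r t", unfolded arg]
      by (simp add: v'_def mills_def real_sqrt_mult sqrts flip: roots)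
    have s: "(?s has_real_derivative x * (a / (R * c)) / T) (at t)"
      using has_real_derivative_sqrt_scaled[OF al(1) t, of x] by (simp add: sqrts roots(7))
    \<comment> \<open>Since \<open>m * sqrt (\<alpha>\<^sub>2 M) = W * sqrt (\<alpha>\<^sub>1
      M)\<close>, both velocities carry the same factor
      \<open>sqrt (\<alpha>\<^sub>1 M) / sqrt t\<close>.\<close>
    have r: "(?r has_real_derivative W * (a / (R * c)) / T) (at t)"
    proof -
      have "m * sqrt (\<alpha>\<^sub>2 M) / sqrt t = W * (a / (R * c)) / T"
        using pos by (simp add: m_def W sqrts roots(7)[symmetric] ac_simps)
      then show ?thesis
        using has_real_derivative_sqrt_scaled[OF al(2) t, of m] by simp
    qed
    have "0 = e / E - \<theta>\<^sub>0 M * (b * d) / (D * (a * c)) * mills m - \<l> M * w / (D * (c * c)) * G"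
    proof -
      have "m = sqrt (\<alpha>\<^sub>1\<^sub>2 M) * (x + \<gamma> M * sqrt pi / (2 * D) * (exp (x\<^sup>2) * erf x))"
        by (simp add: m_def W_temp_def)
      moreover have "G = x + (1 - \<epsilon> M) * \<gamma> M * sqrt pi / (2 * D) * (exp (x\<^sup>2) * erf x)"
        by (simp add: G_def W_def ratio roots(6) algebra_simps)
      ultimately show ?thesis
        using root by (simp add: stefan_balance_def balance_def e_def E_def real_sqrt_mult roots)
          (use adm in \<open>simp add: admissible_def\<close>)
    qed
    \<comment> \<open>The factor turns \<open>e / E\<close> into \<open>k\<^sub>1 M * u'\<close>,
      that is, the dimensionless balance into the balance of heat fluxes.\<close>
    then have "0 = (R * D * a * c / (w * T)) *
      (e / E - \<theta>\<^sub>0 M * (b * d) / (D * (a * c)) * mills m - \<l> M * w / (D * (c * c)) * G)"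
      by simp
    also have "\<dots> = a * a * u' - b * b * v' - R * R * \<l> M * (a / (R * c) / T * G)"
      using pos D_pos eE by (simp add: u'_def v'_def field_simps)
    finally have "k\<^sub>1 M * u' - k\<^sub>2 M * v' = \<rho> M * \<l> M *
        (\<epsilon> M * (x * (a / (R * c)) / T) + (1 - \<epsilon> M) * (W * (a / (R * c)) / T))"
      by (simp add: sq G_def algebra_simps add_divide_distrib diff_divide_distrib)
    moreover have "u' * (?r t - ?s t) = \<gamma> M"
    proof -
      have "?r t - ?s t = 2 * (W - x) * (a / (R * c) * T)"
        using pos by (simp add: m_def W real_sqrt_mult sqrts roots(7)[symmetric] algebra_simps)
      also have "\<dots> = \<gamma> M * w / D * (E / e) * (a / (R * c) * T)"
        by (simp add: W_def)
      finally show ?thesis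
        using pos D_pos eE by (simp add: u'_def)
    qed
    ultimately show ?thesis using u v s r by blast
  qed
  show ?thesis
    unfolding common_equations_def
  proof (intro conjI)
    show "\<forall>t>0. ?u (?s t) t = 0 \<and> ?v (?r t) t = 0"
      using al E by (auto simp: profile_def)
    show "\<forall>x>0. ((\<lambda>t. ?v x t) \<longlongrightarrow> \<theta>\<^sub>0 M) (at_right 0)"
      using tendsto_profile_at_right_0[OF al(2)] far by metis
    show "\<forall>t>0. ((\<lambda>x. ?v x t) \<longlongrightarrow> \<theta>\<^sub>0 M) at_top"
      using tendsto_profile_at_top[OF al(2)] far by metis
  qed (use al heat_eq_at_profile interface in auto)
qed

end

section \<open>The temperature solution in terms of profiles\<close>

lemma \<theta>1_temp_profile:
  "\<theta>1_temp M D = profile (\<alpha>\<^sub>1 M) (- D) (D / erf (\<xi>_temp M D))"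
  by (simp add: fun_eq_iff \<theta>1_temp_def profile_def algebra_simps)

text \<open>The assumption allows \<open>erf (\<mu>_temp M D)\<close> to cancel; at 0 the left side
  would vanish identically.\<close>

lemma \<theta>2_temp_profile:
  assumes "erf (\<mu>_temp M D) \<noteq> 0"
  shows "\<theta>2_temp M D = profile (\<alpha>\<^sub>2 M)
    (- (\<theta>\<^sub>0 M * erf (\<mu>_temp M D) / erfc (\<mu>_temp M D))) (\<theta>\<^sub>0 M / erfc (\<mu>_temp M D))"
  using assms by (simp add: fun_eq_iff \<theta>2_temp_def profile_def Let_def algebra_simps)

lemma solves_temperature_problem_similarity:
  assumes adm: "admissible M" and D: "0 < D" and x: "0 < x" "stefan_balance M D 0 x = 0"
  shows "solves_temperature_problem M D (\<theta>1_temp M D) (\<theta>2_temp M D) (s_temp M D) (r_temp M D)"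
proof -
  have xi: "\<xi>_temp M D = x" by (rule \<xi>_temp_eqI) fact+
  define m where "m = \<mu>_temp M D"
  have m: "m = sqrt (\<alpha>\<^sub>1\<^sub>2 M) * W_temp M D x" by (simp add: m_def \<mu>_temp_def xi)
  have "erf (\<mu>_temp M D) \<noteq> 0"
    using erf_pos[OF m_pos[OF adm D x m]] by (simp add: m_def)
  moreover have "s_temp M D = (\<lambda>t. 2 * x * sqrt (\<alpha>\<^sub>1 M * t))" "r_temp M D = (\<lambda>t. 2 * m * sqrt (\<alpha>\<^sub>2 M * t))"
    by (simp_all add: fun_eq_iff s_temp_def r_temp_def xi m_def)
  ultimately have "common_equations M (\<theta>1_temp M D) (\<theta>2_temp M D) (s_temp M D) (r_temp M D)"
    using common_equations_profile[OF adm D x m]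
    by (simp add: \<theta>1_temp_profile \<theta>2_temp_profile xi m_def)
  then show ?thesis
    by (simp add: solves_temperature_problem_def \<theta>1_temp_profile profile_def)
qed

section \<open>Coincidence of the two similarity solutions\<close>

theorem theorem3p1:
  fixes M :: stefan_data and Dinf h\<^sub>0 D\<^sub>0 \<xi> :: real
  assumes "admissible M" and "0 < Dinf" and "0 < h\<^sub>0"
    and "h_threshold M Dinf < h\<^sub>0"
    and "\<xi> = \<xi>_conv M Dinf h\<^sub>0"
    and "D\<^sub>0 = Dinf * erf \<xi> / (erf \<xi> + k\<^sub>1 M / (h\<^sub>0 * sqrt (pi * \<alpha>\<^sub>1 M)))"
  shows "0 < D\<^sub>0
    \<and> solves_convective_problem M Dinf h\<^sub>0
        (\<theta>1_conv M Dinf h\<^sub>0) (\<theta>2_conv M Dinf h\<^sub>0) (s_conv M Dinf h\<^sub>0) (r_conv M Dinf h\<^sub>0)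
    \<and> solves_temperature_problem M D\<^sub>0
        (\<theta>1_temp M D\<^sub>0) (\<theta>2_temp M D\<^sub>0) (s_temp M D\<^sub>0) (r_temp M D\<^sub>0)
    \<and> \<theta>1_conv M Dinf h\<^sub>0 = \<theta>1_temp M D\<^sub>0
    \<and> \<theta>2_conv M Dinf h\<^sub>0 = \<theta>2_temp M D\<^sub>0
    \<and> s_conv M Dinf h\<^sub>0 = s_temp M D\<^sub>0
    \<and> r_conv M Dinf h\<^sub>0 = r_temp M D\<^sub>0"
proof -
  define K where "K = convective_resistance M h\<^sub>0"
  have K: "0 < K" unfolding K_def by (rule convective_resistance_pos) fact+
  have K': "k\<^sub>1 M / (h\<^sub>0 * sqrt (pi * \<alpha>\<^sub>1 M)) = K" "k\<^sub>1 M / (h\<^sub>0 * sqrt (\<alpha>\<^sub>1 M * pi)) = K"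
    by (simp_all add: K_def convective_resistance_def mult.commute)
  have \<xi>: "0 < \<xi>" "stefan_balance M Dinf K \<xi> = 0"
    using \<xi>_conv_root[OF assms(1-4)] by (simp_all add: assms(5) K_def)
  have E: "0 < erf \<xi>" using erf_pos \<xi>(1) .
  have D\<^sub>0: "D\<^sub>0 = Dinf * erf \<xi> / (erf \<xi> + K)" using assms(6) by (simp add: K')
  have D\<^sub>0_pos: "0 < D\<^sub>0" using E K assms(2) by (simp add: D\<^sub>0)
  have root: "stefan_balance M D\<^sub>0 0 \<xi> = 0"
    using stefan_balance_rescale[OF assms(2) \<xi>(1) less_imp_le[OF K] D\<^sub>0, of M] \<xi>(2) D\<^sub>0_pos by simp
  have \<xi>_temp: "\<xi>_temp M D\<^sub>0 = \<xi>" by (rule \<xi>_temp_eqI) fact+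
  have "W_conv M Dinf h\<^sub>0 \<xi> = W_temp M D\<^sub>0 \<xi>"
    using E K assms(2) by (simp add: W_conv_def W_temp_def K' D\<^sub>0)
  then have \<mu>: "\<mu>_conv M Dinf h\<^sub>0 = \<mu>_temp M D\<^sub>0"
    by (simp add: \<mu>_conv_def \<mu>_temp_def \<xi>_temp flip: assms(5))
  have \<theta>1: "\<theta>1_conv M Dinf h\<^sub>0 = \<theta>1_temp M D\<^sub>0"
    by (simp only: fun_eq_iff \<theta>1_conv_def \<theta>1_temp_def Let_def K' \<xi>_temp flip: assms(5))
      (simp add: D\<^sub>0)
  have \<theta>2: "\<theta>2_conv M Dinf h\<^sub>0 = \<theta>2_temp M D\<^sub>0"
    by (simp add: fun_eq_iff \<theta>2_conv_def \<theta>2_temp_def \<mu>)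
  have s: "s_conv M Dinf h\<^sub>0 = s_temp M D\<^sub>0"
    by (simp add: fun_eq_iff s_conv_def s_temp_def \<xi>_temp flip: assms(5))
  have r: "r_conv M Dinf h\<^sub>0 = r_temp M D\<^sub>0"
    by (simp add: fun_eq_iff r_conv_def r_temp_def \<mu>)
  have temp: "solves_temperature_problem M D\<^sub>0
      (\<theta>1_temp M D\<^sub>0) (\<theta>2_temp M D\<^sub>0) (s_temp M D\<^sub>0) (r_temp M D\<^sub>0)"
    by (rule solves_temperature_problem_similarity) fact+
  \<comment> \<open>The convective condition is checked on the temperature solution, to which the
    convective one has been shown equal. It holds because \<open>Dinf - D\<^sub>0\<close> is
    \<open>K\<close> times \<open>D\<^sub>0 / erf \<xi>\<close>, the factor that determines the
    gradient at the face.\<close>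
  have flux: "\<exists>u'. ((\<lambda>x. \<theta>1_temp M D\<^sub>0 x t) has_real_derivative u') (at 0 within {0..s_temp M D\<^sub>0 t}) \<and>
      k\<^sub>1 M * u' = h\<^sub>0 / sqrt t * (\<theta>1_temp M D\<^sub>0 0 t + Dinf)" if t: "0 < t" for t
  proof -
    have \<alpha>: "0 < \<alpha>\<^sub>1 M" using diffusivities_pos[OF assms(1)] by simp
    let ?u' = "D\<^sub>0 / erf \<xi> / (sqrt pi * sqrt (\<alpha>\<^sub>1 M * t))"
    have "((\<lambda>x. \<theta>1_temp M D\<^sub>0 x t) has_real_derivative ?u') (at 0 within {0..s_temp M D\<^sub>0 t})"
      using has_real_derivative_profile[OF \<alpha> t, of "- D\<^sub>0" "D\<^sub>0 / erf \<xi>" 0]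
      by (simp add: \<theta>1_temp_profile \<xi>_temp)
    moreover have "k\<^sub>1 M * ?u' = h\<^sub>0 / sqrt t * (\<theta>1_temp M D\<^sub>0 0 t + Dinf)"
    proof -
      have "k\<^sub>1 M = K * h\<^sub>0 * (sqrt (\<alpha>\<^sub>1 M) * sqrt pi)"
        using \<alpha> assms(3) by (simp add: K_def convective_resistance_def real_sqrt_mult)
      moreover have "D\<^sub>0 / erf \<xi> = Dinf / (erf \<xi> + K)"
        using E by (simp add: D\<^sub>0)
      moreover have "\<theta>1_temp M D\<^sub>0 0 t + Dinf = K * (Dinf / (erf \<xi> + K))"
        using E K by (simp add: \<theta>1_temp_profile profile_def D\<^sub>0 field_simps)
      ultimately show ?thesis
        using \<alpha> t by (simp add: real_sqrt_mult ac_simps)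
    qed
    ultimately show ?thesis by blast
  qed
  have "solves_convective_problem M Dinf h\<^sub>0
      (\<theta>1_temp M D\<^sub>0) (\<theta>2_temp M D\<^sub>0) (s_temp M D\<^sub>0) (r_temp M D\<^sub>0)"
    using temp flux by (simp add: solves_convective_problem_def solves_temperature_problem_def)
  then show ?thesis
    using D\<^sub>0_pos temp by (simp only: \<theta>1 \<theta>2 s r simp_thms)
qed

end
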